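(* Let $G=(V,E)$ be a graph with finitely many vertices and edges, let $\mathscr{H}$ be the set of all subgraphs of $G$, and let $w:\mathscr{H}\to\mathbb{R}_+$ be a weight function. Define $\widetilde{w}:\mathscr{H}\to\mathbb{R}_+$ by $$\widetilde{w}(H):=\min\Big\{\,w(H_1)+\cdots+w(H_n)\ \Big|\ n\ge 1,\ H_1,\dots,H_n\subseteq H,\ \bigcup_{i=1}^n H_i=H\,\Big\}\qquad (H\in\mathscr{H}).$$ If $w$ is monotone, then $\widetilde{w}$ possesses the same monotonicity; that is, if $w$ is monotone increasing then $\widetilde{w}$ is monotone increasing, and if $w$ is monotone decreasing then $\widetilde{w}$ is monotone decreasing.
   Context: $\mathbb{R}_+$ denotes the set of non-negative real numbers. For subgraphs, $H\subseteq H'$ means that $H$ is a subgraph of $H'$, and the union of subgraphs is the subgraph whose vertex set and edge set are the unions of the respective vertex sets and edge sets. A function $w:\mathscr{H}\to\mathbb{R}_+$ is monotone increasing if $w(H_1)\le w(H_2)$ for all $H_1,H_2\in\mathscr{H}$ with $H_1\subset H_2$, and monotone decreasing if $w(H_1)\ge w(H_2)$ for all $H_1,H_2\in\mathscr{H}$ with $H_1\subset H_2$. In the definition of $\widetilde{w}$, $n$ ranges over all positive integers. *)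

theory Defs
  imports Complex_Main
begin

text \<open>
  Undirected graphs. The edges are abstract objects and \<open>ends e\<close> is the set of end vertices of
  \<open>e\<close>, so loops (one end) and parallel edges are allowed. A simple graph, whose edges are
  two-element sets of vertices, is the case in which \<open>ends\<close> is the identity.
\<close>

record ('v, 'e) graph =
  verts :: "'v set"
  edges :: "'e set"
  ends :: "'e \<Rightarrow> 'v set"

definition finite_graph :: "('v, 'e) graph \<Rightarrow> bool" where
  "finite_graph G \<longleftrightarrow> finite (verts G) \<and> finite (edges G) \<and>
     (\<forall>e\<in>edges G. ends G e \<subseteq> verts G \<and> card (ends G e) \<in> {1, 2})"

text \<open>
  A subgraph of \<open>G\<close> inherits \<open>ends\<close> from \<open>G\<close>, so it is given by its vertex set and its edge set.
  The null graph \<open>({}, {})\<close> is a subgraph.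
\<close>

type_synonym ('v, 'e) subgr = "'v set \<times> 'e set"

definition subgraphs :: "('v, 'e) graph \<Rightarrow> ('v, 'e) subgr set" where
  "subgraphs G =
     {(W, F). W \<subseteq> verts G \<and> F \<subseteq> edges G \<and> (\<forall>e\<in>F. ends G e \<subseteq> W)}"

definition subgraph_of :: "('v, 'e) subgr \<Rightarrow> ('v, 'e) subgr \<Rightarrow> bool" (infix "\<sqsubseteq>" 50) where
  "H \<sqsubseteq> K \<longleftrightarrow> fst H \<subseteq> fst K \<and> snd H \<subseteq> snd K"

definition union_subgraphs :: "('v, 'e) subgr set \<Rightarrow> ('v, 'e) subgr" where
  "union_subgraphs \<C> = (\<Union>H\<in>\<C>. fst H, \<Union>H\<in>\<C>. snd H)"

definition cover_weights ::
    "('v, 'e) graph \<Rightarrow> (('v, 'e) subgr \<Rightarrow> real) \<Rightarrow> ('v, 'e) subgr \<Rightarrow> real set" where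
  "cover_weights G w K =
     {\<Sum>i=1..n. w (H i) | (n::nat) H.
        n \<ge> 1 \<and> (\<forall>i\<in>{1..n}. H i \<in> subgraphs G \<and> H i \<sqsubseteq> K) \<and>
        union_subgraphs (H ` {1..n}) = K}"

text \<open>
  The set \<open>cover_weights G w K\<close> is in general infinite, so its minimum is written with \<open>LEAST\<close>
  instead of \<open>Min\<close>. It exists by \<open>cover_weight_minimum\<close> below.
\<close>

definition wtilde ::
    "('v, 'e) graph \<Rightarrow> (('v, 'e) subgr \<Rightarrow> real) \<Rightarrow> ('v, 'e) subgr \<Rightarrow> real" where
  "wtilde G w K = (LEAST s. s \<in> cover_weights G w K)"

lemma finite_subgraphs:
  assumes "finite_graph G"
  shows "finite (subgraphs G)"
proof (rule finite_subset)
  show "subgraphs G \<subseteq> Pow (verts G) \<times> Pow (edges G)"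
    by (auto simp: subgraphs_def)
  show "finite (Pow (verts G) \<times> Pow (edges G))"
    using assms by (simp add: finite_graph_def)
qed

lemma cover_weight_minimum:
  assumes G: "finite_graph G"
    and w: "\<forall>H\<in>subgraphs G. 0 \<le> w H"
    and K: "K \<in> subgraphs G"
  shows "wtilde G w K \<in> cover_weights G w K"
    and "\<And>s. s \<in> cover_weights G w K \<Longrightarrow> wtilde G w K \<le> s"
    and "0 \<le> wtilde G w K"
proof -
  define \<D> where "\<D> = {\<C>. \<C> \<subseteq> subgraphs G \<and> \<C> \<noteq> {} \<and> (\<forall>H\<in>\<C>. H \<sqsubseteq> K) \<and> union_subgraphs \<C> = K}"
  have finS: "finite (subgraphs G)" using G by (rule finite_subgraphs)
  have fin: "finite \<D>"
    by (rule finite_subset[of _ "Pow (subgraphs G)"]) (auto simp: \<D>_def finS)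
  have "{K} \<in> \<D>"
    using K by (auto simp: \<D>_def union_subgraphs_def subgraph_of_def)
  then have ne: "\<D> \<noteq> {}" by blast
  have realised: "sum w \<C> \<in> cover_weights G w K" if "\<C> \<in> \<D>" for \<C>
  proof -
    have "finite \<C>" using that finS finite_subset by (auto simp: \<D>_def)
    then obtain h where h: "bij_betw h {1..card \<C>} \<C>"
      using ex_bij_betw_nat_finite_1 by blast
    have img: "h ` {1..card \<C>} = \<C>" using h by (simp add: bij_betw_def)
    have "card \<C> \<ge> 1"
      using that \<open>finite \<C>\<close> by (simp add: \<D>_def Suc_le_eq card_gt_0_iff)
    moreover have "sum w \<C> = (\<Sum>i=1..card \<C>. w (h i))"
      using sum.reindex_bij_betw[OF h, of w] by simp
    moreover have "\<forall>i\<in>{1..card \<C>}. h i \<in> subgraphs G \<and> h i \<sqsubseteq> K"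
      using that img unfolding \<D>_def by blast
    moreover have "union_subgraphs (h ` {1..card \<C>}) = K"
      using that unfolding img \<D>_def by blast
    ultimately show ?thesis unfolding cover_weights_def by blast
  qed
  have bound: "\<exists>\<C>\<in>\<D>. sum w \<C> \<le> s" if s: "s \<in> cover_weights G w K" for s
  proof -
    obtain n :: nat and H where H: "s = (\<Sum>i=1..n. w (H i))" "n \<ge> 1"
      "\<forall>i\<in>{1..n}. H i \<in> subgraphs G \<and> H i \<sqsubseteq> K" "union_subgraphs (H ` {1..n}) = K"
      using s unfolding cover_weights_def by blast
    have "H ` {1..n} \<in> \<D>" using H by (auto simp: \<D>_def)
    moreover have "sum w (H ` {1..n}) \<le> (\<Sum>i=1..n. w (H i))"
      using sum_image_le[of "{1..n}" w H] H(3) w by (auto simp: o_def)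
    ultimately show ?thesis using H(1) by blast
  qed
  define m where "m = Min (sum w ` \<D>)"
  have "m \<in> sum w ` \<D>" unfolding m_def using fin ne by (intro Min_in) auto
  then have m_in: "m \<in> cover_weights G w K" using realised by blast
  have m_le: "m \<le> s" if "s \<in> cover_weights G w K" for s
    using bound[OF that] fin unfolding m_def by (meson Min_le finite_imageI image_eqI order_trans)
  have eq: "wtilde G w K = m"
    unfolding wtilde_def using m_in m_le by (rule Least_equality)
  show "wtilde G w K \<in> cover_weights G w K" using m_in eq by simp
  show "\<And>s. s \<in> cover_weights G w K \<Longrightarrow> wtilde G w K \<le> s" using m_le eq by simp
  have "0 \<le> s" if "s \<in> cover_weights G w K" for s
    using that w unfolding cover_weights_def by (auto intro!: sum_nonneg)
  then show "0 \<le> wtilde G w K" using m_in eq by simp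
qed

end

(* Increasing case: intersecting an optimal cover of K with a subgraph H of K gives a cover of H
   of no greater weight. Decreasing case: any cover of H has a first member H 1, and K alone is a
   cover of K with w K \<le> w (H 1), the other weights being nonnegative. *)

theory Submission
  imports Defs
begin

definition inter_subgr :: "('v, 'e) subgr \<Rightarrow> ('v, 'e) subgr \<Rightarrow> ('v, 'e) subgr" where
  "inter_subgr H K = (fst H \<inter> fst K, snd H \<inter> snd K)"

text \<open>An edge common to both subgraphs has its ends in both vertex sets, so no edge of the
  intersection loses an end.\<close>

lemma inter_subgr_in_subgraphs:
  assumes "H \<in> subgraphs G" and "K \<in> subgraphs G"
  shows "inter_subgr H K \<in> subgraphs G"
  using assms by (fastforce simp: subgraphs_def inter_subgr_def)

lemma inter_subgr_lower:
  shows "inter_subgr H K \<sqsubseteq> H" and "inter_subgr H K \<sqsubseteq> K"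
  by (auto simp: subgraph_of_def inter_subgr_def)

text \<open>Intersection distributes over unions of vertex sets and of edge sets, and
  \<open>K\<close> meets \<open>H\<close> in \<open>H\<close> itself. Hence the traces on
  \<open>H\<close> of a cover of \<open>K\<close> form a cover of \<open>H\<close>.\<close>

lemma union_subgraphs_inter_subgr:
  assumes "union_subgraphs (f ` I) = K" and "H \<sqsubseteq> K"
  shows "union_subgraphs ((\<lambda>i. inter_subgr (f i) H) ` I) = H"
proof (rule prod_eqI)
  have K: "fst K = (\<Union>i\<in>I. fst (f i))" "snd K = (\<Union>i\<in>I. snd (f i))"
    using assms(1) by (auto simp: union_subgraphs_def)
  show "fst (union_subgraphs ((\<lambda>i. inter_subgr (f i) H) ` I)) = fst H"
    and "snd (union_subgraphs ((\<lambda>i. inter_subgr (f i) H) ` I)) = snd H"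
    using assms(2) K by (auto simp: union_subgraphs_def inter_subgr_def subgraph_of_def)
qed

lemma weight_in_cover_weights:
  assumes "K \<in> subgraphs G"
  shows "w K \<in> cover_weights G w K"
  unfolding cover_weights_def
  \<comment> \<open>The cover has the single member \<open>K\<close>, so \<open>n\<close> is 1 and
    the sum has one term.\<close>
  by (rule CollectI, rule exI[of _ "1::nat"], rule exI[of _ "\<lambda>_. K"])
    (use assms in \<open>auto simp: union_subgraphs_def subgraph_of_def\<close>)

lemma wtilde_increasing:
  assumes G: "finite_graph G"
    and nonneg: "\<forall>H\<in>subgraphs G. 0 \<le> w H"
    and mono: "monotone_on (subgraphs G) (\<sqsubseteq>) (\<le>) w"
  shows "monotone_on (subgraphs G) (\<sqsubseteq>) (\<le>) (wtilde G w)"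
proof (rule monotone_onI)
  fix H K assume H: "H \<in> subgraphs G" and K: "K \<in> subgraphs G" and HK: "H \<sqsubseteq> K"
  \<comment> \<open>The minimum is attained, so an optimal cover of \<open>K\<close> can be
    fixed.\<close>
  obtain n :: nat and f where f: "wtilde G w K = (\<Sum>i=1..n. w (f i))" "n \<ge> 1"
    "\<forall>i\<in>{1..n}. f i \<in> subgraphs G \<and> f i \<sqsubseteq> K" "union_subgraphs (f ` {1..n}) = K"
    using cover_weight_minimum(1)[OF G nonneg K] unfolding cover_weights_def by blast
  let ?g = "\<lambda>i. inter_subgr (f i) H"
  have g: "?g i \<in> subgraphs G" "?g i \<sqsubseteq> f i" "?g i \<sqsubseteq> H" if "i \<in> {1..n}" for i
    using that f(3) H by (auto intro: inter_subgr_in_subgraphs inter_subgr_lower)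
  \<comment> \<open>Traces of different members may coincide or be the null graph. Covers are
    indexed families of subgraphs, so the same \<open>n\<close> still serves.\<close>
  have "(\<Sum>i=1..n. w (?g i)) \<in> cover_weights G w H"
    unfolding cover_weights_def
    by (rule CollectI, rule exI[of _ n], rule exI[of _ ?g])
      (use f(2) g union_subgraphs_inter_subgr[OF f(4) HK] in auto)
  then have "wtilde G w H \<le> (\<Sum>i=1..n. w (?g i))"
    by (rule cover_weight_minimum(2)[OF G nonneg H])
  \<comment> \<open>Since \<open>?g i \<sqsubseteq> f i\<close>, the comparison holds term by
    term.\<close>
  also have "\<dots> \<le> (\<Sum>i=1..n. w (f i))"
    using f(3) g by (intro sum_mono monotone_onD[OF mono]) auto
  finally show "wtilde G w H \<le> wtilde G w K"
    by (simp add: f(1))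
qed

lemma wtilde_decreasing:
  assumes G: "finite_graph G"
    and nonneg: "\<forall>H\<in>subgraphs G. 0 \<le> w H"
    and mono: "monotone_on (subgraphs G) (\<sqsubseteq>) (\<ge>) w"
  shows "monotone_on (subgraphs G) (\<sqsubseteq>) (\<ge>) (wtilde G w)"
proof (rule monotone_onI)
  fix H K assume H: "H \<in> subgraphs G" and K: "K \<in> subgraphs G" and HK: "H \<sqsubseteq> K"
  obtain n :: nat and f where f: "wtilde G w H = (\<Sum>i=1..n. w (f i))" "n \<ge> 1"
    "\<forall>i\<in>{1..n}. f i \<in> subgraphs G \<and> f i \<sqsubseteq> H"
    using cover_weight_minimum(1)[OF G nonneg H] unfolding cover_weights_def by blast
  \<comment> \<open>The index 1 is available because \<open>n \<ge> 1\<close>: even the null graph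
    has no cover by zero subgraphs.\<close>
  have f1: "f 1 \<in> subgraphs G" "f 1 \<sqsubseteq> H"
    using f(2,3) by auto
  have "wtilde G w K \<le> w K"
    by (rule cover_weight_minimum(2)[OF G nonneg K weight_in_cover_weights[OF K]])
  \<comment> \<open>By transitivity through \<open>H\<close>, \<open>f 1\<close> is a subgraph of
    \<open>K\<close>, and \<open>w\<close> reverses this relation.\<close>
  also have "w K \<le> w (f 1)"
    using f1 HK by (intro monotone_onD[OF mono _ K]) (auto simp: subgraph_of_def)
  also have "w (f 1) \<le> (\<Sum>i=1..n. w (f i))"
    using f(2,3) nonneg by (intro member_le_sum) auto
  finally show "wtilde G w H \<ge> wtilde G w K"
    by (simp add: f(1))
qed

theorem proposition1p5:
  fixes G :: "('v, 'e) graph" and w :: "('v, 'e) subgr \<Rightarrow> real"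
  assumes "finite_graph G"
    and "\<forall>H\<in>subgraphs G. 0 \<le> w H"
  shows "(monotone_on (subgraphs G) (\<sqsubseteq>) (\<le>) w \<longrightarrow>
            monotone_on (subgraphs G) (\<sqsubseteq>) (\<le>) (wtilde G w)) \<and>
         (monotone_on (subgraphs G) (\<sqsubseteq>) (\<ge>) w \<longrightarrow>
            monotone_on (subgraphs G) (\<sqsubseteq>) (\<ge>) (wtilde G w))"
  using wtilde_increasing[OF assms] wtilde_decreasing[OF assms] by blast

end
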